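(* There is a constant $c>0$, independent of $m$ and $f$, such that for every integer $m\ge 0$ and every $f\in C(B)$, $$\max_{(x,y)\in\Omega_m}\left|\mathcal{A}\mathcal{I}_{2m}f(x,y)\right|\le c\,\|f\|\,m\log(m+1),$$ where $\Omega_m=\{(x,y)\in\mathbb{R}^2:\sqrt{x^2+y^2}\le\cos\frac{\pi}{2m+1}\}$ and $\|f\|$ is the uniform norm of $f$ on $B$. (For $m=0$ the set $\Omega_0$ is empty and the statement is vacuous.)
   Context: $B=\{(x,y)\in\mathbb{R}^2:x^2+y^2\le 1\}$ is the closed unit disk and $\|\cdot\|$ is the uniform norm on $B$. The Radon projection of $f\in C(B)$ is the line integral (with respect to arc length) $$\mathcal{R}f(\theta,t)=\int_{I(\theta,t)}f\,ds,\qquad I(\theta,t)=\{(x,y):x\cos\theta+y\sin\theta=t\}\cap B,\quad 0\le\theta\le 2\pi,\ -1\le t\le 1.$$ For an integer $m\ge1$ put $\phi_\nu=\frac{2\pi\nu}{2m+1}$ ($0\le\nu\le 2m$), $\psi_j=\frac{(2j+1)\pi}{4m+2}$ ($0\le j\le 2m$), and $\xi_l=\frac{(l+1)\pi}{2m+1}$ ($0\le l\le 2m-1$). Define $$S_{k,\nu}=\frac{k+1}{(2m+1)^2}\sum_{j=0}^{2m}\mathcal{R}f(\phi_\nu,\cos\psi_j)\,\sin((k+1)\psi_j),\qquad \alpha_{l,\nu}=\sum_{k=0}^{2m}S_{k,\nu}\sin((k+1)\xi_l).$$ Let $\ell_\nu$ be the piecewise linear interpolant of these values: for $\xi_l\le\theta\le\xi_{l+1}$,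 $$\ell_\nu(\theta)=u_\nu(\theta)\,\alpha_{l+1,\nu}+(1-u_\nu(\theta))\,\alpha_{l,\nu},\qquad u_\nu(\theta)=\frac{\theta-\xi_l}{\xi_{l+1}-\xi_l}.$$ With $\theta_\nu(x,y)=\arccos(x\cos\phi_\nu+y\sin\phi_\nu)$, the operator (OPED algorithm with linear interpolation) is $$\mathcal{A}\mathcal{I}_{2m}f(x,y)=\sum_{\nu=0}^{2m}\frac{1}{\sin\theta_\nu(x,y)}\,\ell_\nu(\theta_\nu(x,y)),$$ which is well defined for $(x,y)\in\Omega_m$, since then $\theta_\nu(x,y)\in[\xi_0,\xi_{2m-1}]$. *)

theory Defs
  imports "HOL-Analysis.Analysis"
begin

definition unit_disk :: "(real \<times> real) set" where
  "unit_disk = {(x, y). x\<^sup>2 + y\<^sup>2 \<le> 1}"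

definition unif_norm :: "(real \<times> real \<Rightarrow> real) \<Rightarrow> real" where
  "unif_norm f = (SUP p\<in>unit_disk. \<bar>f p\<bar>)"

definition chord :: "real \<Rightarrow> real \<Rightarrow> (real \<times> real) set" where
  "chord \<theta> t = {(x, y). x * cos \<theta> + y * sin \<theta> = t} \<inter> unit_disk"

definition line_point :: "real \<Rightarrow> real \<Rightarrow> real \<Rightarrow> real \<times> real" where
  "line_point \<theta> t s = (t * cos \<theta> - s * sin \<theta>, t * sin \<theta> + s * cos \<theta>)"

(* line_point \<theta> t is a unit-speed parametrization of the whole line x cos \<theta> + y sin \<theta> = t,
   so the line integral with respect to arc length is an ordinary integral in s. *)
definition radon :: "(real \<times> real \<Rightarrow> real) \<Rightarrow> real \<Rightarrow> real \<Rightarrow> real" where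
  "radon f \<theta> t =
     integral {s. line_point \<theta> t s \<in> chord \<theta> t} (\<lambda>s. f (line_point \<theta> t s))"

definition phi :: "nat \<Rightarrow> nat \<Rightarrow> real" where
  "phi m \<nu> = 2 * pi * real \<nu> / (2 * real m + 1)"

definition psi :: "nat \<Rightarrow> nat \<Rightarrow> real" where
  "psi m j = (2 * real j + 1) * pi / (4 * real m + 2)"

definition xi :: "nat \<Rightarrow> nat \<Rightarrow> real" where
  "xi m l = (real l + 1) * pi / (2 * real m + 1)"

definition S_coeff :: "nat \<Rightarrow> (real \<times> real \<Rightarrow> real) \<Rightarrow> nat \<Rightarrow> nat \<Rightarrow> real" where
  "S_coeff m f k \<nu> = (real k + 1) / (2 * real m + 1)\<^sup>2 *
     (\<Sum>j = 0..2 * m. radon f (phi m \<nu>) (cos (psi m j)) * sin ((real k + 1) * psi m j))"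

definition alpha_coeff :: "nat \<Rightarrow> (real \<times> real \<Rightarrow> real) \<Rightarrow> nat \<Rightarrow> nat \<Rightarrow> real" where
  "alpha_coeff m f l \<nu> = (\<Sum>k = 0..2 * m. S_coeff m f k \<nu> * sin ((real k + 1) * xi m l))"

definition interp_weight :: "nat \<Rightarrow> nat \<Rightarrow> real \<Rightarrow> real" where
  "interp_weight m l \<theta> = (\<theta> - xi m l) / (xi m (l + 1) - xi m l)"

definition lin_piece :: "nat \<Rightarrow> (real \<times> real \<Rightarrow> real) \<Rightarrow> nat \<Rightarrow> nat \<Rightarrow> real \<Rightarrow> real" where
  "lin_piece m f \<nu> l \<theta> =
     interp_weight m l \<theta> * alpha_coeff m f (l + 1) \<nu> + (1 - interp_weight m l \<theta>) * alpha_coeff m f l \<nu>"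

(* The nodes are xi m 0, ..., xi m (2 * m - 1). At an interior node two indices l are admissible,
   but both give the same value (see lin_interp_eq). Outside [xi m 0, xi m (2 * m - 1)] the value
   is arbitrary. *)
definition lin_interp :: "nat \<Rightarrow> (real \<times> real \<Rightarrow> real) \<Rightarrow> nat \<Rightarrow> real \<Rightarrow> real" where
  "lin_interp m f \<nu> \<theta> =
     lin_piece m f \<nu> (SOME l. l + 1 < 2 * m \<and> xi m l \<le> \<theta> \<and> \<theta> \<le> xi m (l + 1)) \<theta>"

definition theta :: "nat \<Rightarrow> nat \<Rightarrow> real \<times> real \<Rightarrow> real" where
  "theta m \<nu> = (\<lambda>(x, y). arccos (x * cos (phi m \<nu>) + y * sin (phi m \<nu>)))"

definition oped_lin :: "nat \<Rightarrow> (real \<times> real \<Rightarrow> real) \<Rightarrow> real \<times> real \<Rightarrow> real" where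
  "oped_lin m f p =
     (\<Sum>\<nu> = 0..2 * m. 1 / sin (theta m \<nu> p) * lin_interp m f \<nu> (theta m \<nu> p))"

definition Omega :: "nat \<Rightarrow> (real \<times> real) set" where
  "Omega m = {(x, y). sqrt (x\<^sup>2 + y\<^sup>2) \<le> cos (pi / (2 * real m + 1))}"

lemma radon_eq:
  "radon f \<theta> t =
    integral {- sqrt (1 - t\<^sup>2)..sqrt (1 - t\<^sup>2)} (\<lambda>s. f (line_point \<theta> t s))"
proof -
  have "(t * b - s * a) * b + (t * a + s * b) * a = t * (a\<^sup>2 + b\<^sup>2)" for a b s :: real
    by (simp add: power2_eq_square algebra_simps)
  then have on_line: "(t * cos \<theta> - s * sin \<theta>) * cos \<theta> + (t * sin \<theta> + s * cos \<theta>) * sin \<theta> = t" for s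
    by (metis sin_cos_squared_add mult_1_right)
  have "(t * b - s * a)\<^sup>2 + (t * a + s * b)\<^sup>2 = (t\<^sup>2 + s\<^sup>2) * (a\<^sup>2 + b\<^sup>2)" for a b s :: real
    by (simp add: power2_eq_square algebra_simps)
  then have nrm: "(t * cos \<theta> - s * sin \<theta>)\<^sup>2 + (t * sin \<theta> + s * cos \<theta>)\<^sup>2 = t\<^sup>2 + s\<^sup>2" for s
    by (metis sin_cos_squared_add mult_1_right)
  have "t\<^sup>2 + s\<^sup>2 \<le> 1 \<longleftrightarrow> - sqrt (1 - t\<^sup>2) \<le> s \<and> s \<le> sqrt (1 - t\<^sup>2)" for s
  proof -
    have "t\<^sup>2 + s\<^sup>2 \<le> 1 \<longleftrightarrow> s\<^sup>2 \<le> 1 - t\<^sup>2" by linarith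
    also have "\<dots> \<longleftrightarrow> sqrt (s\<^sup>2) \<le> sqrt (1 - t\<^sup>2)" by (rule real_sqrt_le_iff[symmetric])
    also have "\<dots> \<longleftrightarrow> \<bar>s\<bar> \<le> sqrt (1 - t\<^sup>2)" by (simp only: real_sqrt_abs)
    finally show ?thesis by linarith
  qed
  then have "{s. line_point \<theta> t s \<in> chord \<theta> t} = {- sqrt (1 - t\<^sup>2)..sqrt (1 - t\<^sup>2)}"
    unfolding chord_def line_point_def unit_disk_def by (simp add: on_line nrm set_eq_iff)
  then show ?thesis unfolding radon_def by (rule arg_cong)
qed

lemma lin_interp_eq:
  assumes "l + 1 < 2 * m" "xi m l \<le> \<theta>" "\<theta> \<le> xi m (l + 1)"
  shows "lin_interp m f \<nu> \<theta> = lin_piece m f \<nu> l \<theta>"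
proof -
  have mono: "xi m i < xi m j \<longleftrightarrow> i < j" for i j
  proof -
    have "0 < pi / (2 * real m + 1)" by simp
    then show ?thesis
      unfolding xi_def times_divide_eq_right[symmetric] by (subst mult_less_cancel_right_pos) auto
  qed
  have adj: "lin_piece m f \<nu> i \<theta> = lin_piece m f \<nu> j \<theta>"
    if "xi m i \<le> \<theta>" "\<theta> \<le> xi m (i + 1)" "xi m j \<le> \<theta>" "\<theta> \<le> xi m (j + 1)" "i < j" for i j
  proof -
    have "\<not> xi m (i + 1) < xi m j" using that by linarith
    then have j: "j = i + 1" using mono[of "i + 1" j] that(5) by linarith
    then have t: "\<theta> = xi m (i + 1)" using that by simp
    have "xi m i < xi m (i + 1)" by (simp add: mono)
    then have "interp_weight m i \<theta> = 1" "interp_weight m j \<theta> = 0"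
      by (simp_all add: interp_weight_def t j)
    then show ?thesis by (simp add: lin_piece_def j)
  qed
  define k where "k = (SOME l. l + 1 < 2 * m \<and> xi m l \<le> \<theta> \<and> \<theta> \<le> xi m (l + 1))"
  have k: "k + 1 < 2 * m \<and> xi m k \<le> \<theta> \<and> \<theta> \<le> xi m (k + 1)"
    unfolding k_def by (rule someI[of _ l]) (use assms in blast)
  have "lin_piece m f \<nu> k \<theta> = lin_piece m f \<nu> l \<theta>"
  proof (cases k l rule: linorder_cases)
    case less
    then show ?thesis using adj k assms by blast
  next
    case equal
    then show ?thesis by (rule arg_cong)
  next
    case greater
    then have "lin_piece m f \<nu> l \<theta> = lin_piece m f \<nu> k \<theta>" using adj k assms by blast
    then show ?thesis by (rule sym)
  qed
  then show ?thesis by (simp only: lin_interp_def k_def)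
qed

end

theory Submission
  imports Defs
begin

text \<open>
  Write \<open>N = 2 * m + 1\<close>. Exchanging the two finite sums shows that the coefficient at the node
  \<open>\<xi>\<close> is \<open>1 / N\<^sup>2\<close> times the sum over the angles \<open>\<psi>\<close> of the Radon projections against the kernel
  \<open>\<Sum>k = 1..N. k * sin (k * \<psi>) * sin (k * \<xi>)\<close>. A chord at distance \<open>cos \<psi>\<close> from the centre
  has length \<open>2 * sin \<psi>\<close>, so each projection is at most \<open>2 * sin \<psi>\<close> times the uniform norm.

  Estimating the kernel alone by absolute values would lose the decisive factor \<open>sin \<xi>\<close>. The two
  grids are interlaced: \<open>N * \<psi>\<close> is an odd multiple of \<open>pi / 2\<close> and \<open>N * \<xi>\<close> a multiple of \<open>pi\<close>.
  There the kernel has a closed form (\<open>sine_kernel_at_nodes\<close>) from which \<open>sin \<xi>\<close> factors out: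
  it is \<open>sin \<xi> / 2\<close> times
  \<open>\<epsilon> * N / (2 * s * t) - sin \<psi> / (4 * s\<^sup>2 * t\<^sup>2)\<close>, where \<open>s = sin ((\<psi> - \<xi>) / 2)\<close>,
  \<open>t = sin ((\<psi> + \<xi>) / 2)\<close> and \<open>\<bar>\<epsilon>\<bar> \<le> 1\<close>.
  Concavity of the sine gives \<open>sin \<psi> \<le> 2 * t\<close>, so the weight \<open>sin \<psi>\<close> from the chord length absorbs
  every \<open>t\<close>. What remains is controlled by \<open>1 / s\<close>, that is, by the
  reciprocal distance of \<open>\<psi>\<close> and \<open>\<xi>\<close>; in units of \<open>pi / (2 * N)\<close> these distances are odd
  integers, each occurring at most twice. The sum over \<open>\<psi>\<close> is thus harmonic and grows
  like \<open>ln m\<close>. Hence the coefficient at \<open>\<xi>\<close> is bounded by a constant times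
  \<open>sin \<xi> * ln (m + 1)\<close> (\<open>alpha_coeff_bound\<close>).

  Linear interpolation preserves such a bound, again because the sine is concave: a convex
  combination of its values at two nodes is at most its value at the combined point \<open>\<theta>\<close>
  (\<open>lin_interp_bound\<close>). The factor \<open>1 / sin \<theta>\<close> in the operator cancels it exactly, each of the
  \<open>N\<close> directions contributes \<open>O(ln (m + 1))\<close>, and \<open>N \<le> 3 * m\<close> gives the claim.
\<close>

section \<open>Concavity of the sine on a half period\<close>

lemma concave_on_sin: "concave_on {0..pi} sin"
  unfolding concave_on_def
proof (rule convex_on_realI)
  show "connected {0..pi}" by simp
  show "((\<lambda>x. - sin x) has_real_derivative - cos x) (at x)" for x :: real
    by (auto intro!: derivative_eq_intros)
  show "- cos x \<le> - cos y" if "x \<in> {0..pi}" "y \<in> {0..pi}" "x \<le> y" for x y :: real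
    using that cos_monotone_0_pi_le[of x y] by simp
qed

text \<open>By concavity the graph of the sine on \<open>{0..pi / 2}\<close> lies above its chord.\<close>

lemma Jordan_sin_ineq:
  fixes x :: real
  assumes "\<bar>x\<bar> \<le> pi / 2"
  shows "2 / pi * \<bar>x\<bar> \<le> \<bar>sin x\<bar>"
proof -
  have "2 / pi * \<bar>x\<bar> \<le> 1"
    using assms by (simp add: field_simps)
  then have "2 / pi * \<bar>x\<bar> \<le> sin \<bar>x\<bar>"
    using concave_onD[OF concave_on_sin, of "2 / pi * \<bar>x\<bar>" 0 "pi / 2"] by simp
  also have "sin \<bar>x\<bar> \<le> \<bar>sin x\<bar>"
    by (simp add: abs_if)
  finally show ?thesis .
qed

section \<open>The weighted sine kernel\<close>

definition sine_kernel :: "nat \<Rightarrow> real \<Rightarrow> real \<Rightarrow> real" where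
  "sine_kernel n \<psi> \<xi> = (\<Sum>k<n. (real k + 1) * sin ((real k + 1) * \<psi>) * sin ((real k + 1) * \<xi>))"

text \<open>
  Multiplying by \<open>2 * (1 - cos x)\<close> takes second differences of the cosines, which makes a sum with
  linear weights telescope.
\<close>

lemma weighted_cos_sum:
  fixes x :: real
  shows "2 * (1 - cos x) * (\<Sum>k<n. (real k + 1) * cos ((real k + 1) * x)) =
    real n * (cos (real n * x) - cos ((real n + 1) * x)) - (1 - cos (real n * x))"
proof (induction n)
  case 0
  show ?case by simp
next
  case (Suc n)
  define c where "c k = cos ((real n + real k) * x)" for k :: nat
  have "(real n + real 0) * x = (real n + real 1) * x - x"
       "(real n + real 2) * x = (real n + real 1) * x + x"
    by (simp_all add: algebra_simps)
  then have rec: "cos x * c 1 = (c 0 + c 2) / 2"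
    unfolding c_def by (simp only: cos_diff cos_add) simp
  have "2 * (1 - cos x) * (\<Sum>k<Suc n. (real k + 1) * cos ((real k + 1) * x)) =
      real n * (c 0 - c 1) - (1 - c 0) + 2 * (1 - cos x) * ((real n + 1) * c 1)"
    using Suc by (simp add: c_def distrib_left)
  also have "\<dots> = real n * (c 0 - c 1) - (1 - c 0) + 2 * (real n + 1) * (c 1 - cos x * c 1)"
    by (simp add: algebra_simps)
  also have "\<dots> = (real n + 1) * (c 1 - c 2) - (1 - c 1)"
    unfolding rec by (simp add: field_simps)
  finally show ?case
    by (simp add: c_def add.commute add.left_commute)
qed

text \<open>
  At a zero of \<open>cos (n * x)\<close> only one boundary cosine survives, and the half angle \<open>u = x / 2\<close>
  turns the sum into a cotangent and a squared cosecant. The cotangents are what allows two such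
  sums to be subtracted neatly.
\<close>

lemma weighted_cos_sum_at_zero:
  fixes u :: real
  assumes "cos (2 * real n * u) = 0" "sin u \<noteq> 0"
  shows "(\<Sum>k<n. (real k + 1) * cos ((real k + 1) * (2 * u))) =
    real n * sin (2 * real n * u) * cos u / (2 * sin u) - 1 / (4 * (sin u)\<^sup>2)"
proof -
  let ?S = "\<Sum>k<n. (real k + 1) * cos ((real k + 1) * (2 * u))"
  have z: "cos (real n * (2 * u)) = 0"
    using assms(1) by (simp add: mult_ac)
  have "(real n + 1) * (2 * u) = 2 * real n * u + 2 * u"
    by (simp add: algebra_simps)
  then have "cos ((real n + 1) * (2 * u)) = - (sin (2 * real n * u) * (2 * sin u * cos u))"
    by (simp only: cos_add assms(1) sin_double)
  then have "2 * (1 - cos (2 * u)) * ?S = 2 * real n * sin (2 * real n * u) * sin u * cos u - 1"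
    using weighted_cos_sum[of "2 * u" n] z by simp
  moreover have "2 * (1 - cos (2 * u)) = 4 * (sin u)\<^sup>2"
    by (simp add: cos_double_sin)
  ultimately have "4 * (sin u)\<^sup>2 * ?S = 2 * real n * sin (2 * real n * u) * sin u * cos u - 1"
    by simp
  then have "?S = (2 * real n * sin (2 * real n * u) * sin u * cos u - 1) / (4 * (sin u)\<^sup>2)"
    using assms(2) by (simp add: field_simps)
  also have "\<dots> = real n * sin (2 * real n * u) * cos u / (2 * sin u) - 1 / (4 * (sin u)\<^sup>2)"
    using assms(2) by (simp add: field_simps power2_eq_square)
  finally show ?thesis .
qed

text \<open>
  The product of sines is half a difference of cosines at \<open>\<psi> - \<xi>\<close> and \<open>\<psi> + \<xi>\<close>. As
  \<open>sin (n * \<xi>) = 0\<close>, the signs \<open>sin (n * (\<psi> - \<xi>))\<close> and \<open>sin (n * (\<psi> + \<xi>))\<close> agree. The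
  difference of the two cotangents then has numerator \<open>sin \<xi>\<close>, and the difference of the
  squared cosecants has numerator \<open>sin \<psi> * sin \<xi>\<close>, so that \<open>sin \<xi>\<close> is a common factor.
\<close>

lemma sine_kernel_at_nodes:
  fixes \<psi> \<xi> :: real
  defines "s \<equiv> sin ((\<psi> - \<xi>) / 2)" and "t \<equiv> sin ((\<psi> + \<xi>) / 2)"
  assumes \<psi>: "cos (real n * \<psi>) = 0" and \<xi>: "sin (real n * \<xi>) = 0"
    and s: "s \<noteq> 0" and t: "t \<noteq> 0"
  shows "sine_kernel n \<psi> \<xi> =
    sin \<xi> / 2 * (real n * (sin (real n * \<psi>) * cos (real n * \<xi>)) / (2 * s * t)
      - sin \<psi> / (4 * s\<^sup>2 * t\<^sup>2))"
proof -
  define \<epsilon> where "\<epsilon> = sin (real n * \<psi>) * cos (real n * \<xi>)"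
  define u v where "u = (\<psi> - \<xi>) / 2" and "v = (\<psi> + \<xi>) / 2"
  have uv: "2 * u = \<psi> - \<xi>" "2 * v = \<psi> + \<xi>" "v + u = \<psi>" "v - u = \<xi>"
    by (simp_all add: u_def v_def field_simps)
  have n_uv: "2 * real n * u = real n * \<psi> - real n * \<xi>" "2 * real n * v = real n * \<psi> + real n * \<xi>"
    by (simp_all add: u_def v_def field_simps)
  have st: "s = sin u" "t = sin v"
    by (simp_all add: s_def t_def u_def v_def)
  have u_sum: "(\<Sum>k<n. (real k + 1) * cos ((real k + 1) * (\<psi> - \<xi>))) =
      real n * \<epsilon> * cos u / (2 * s) - 1 / (4 * s\<^sup>2)"
    using weighted_cos_sum_at_zero[of n u] s \<psi> \<xi>
    unfolding n_uv by (simp add: uv st \<epsilon>_def cos_diff sin_diff)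
  have v_sum: "(\<Sum>k<n. (real k + 1) * cos ((real k + 1) * (\<psi> + \<xi>))) =
      real n * \<epsilon> * cos v / (2 * t) - 1 / (4 * t\<^sup>2)"
    using weighted_cos_sum_at_zero[of n v] t \<psi> \<xi>
    unfolding n_uv by (simp add: uv st \<epsilon>_def cos_add sin_add)
  have "2 * sine_kernel n \<psi> \<xi> =
      (\<Sum>k<n. (real k + 1) * cos ((real k + 1) * (\<psi> - \<xi>))) -
      (\<Sum>k<n. (real k + 1) * cos ((real k + 1) * (\<psi> + \<xi>)))"
    unfolding sine_kernel_def sum_distrib_left sum_subtractf[symmetric]
    by (intro sum.cong refl)
      (simp only: right_diff_distrib distrib_left[of _ \<psi> \<xi>] cos_diff cos_add, simp add: algebra_simps)
  also have "\<dots> = real n * \<epsilon> * (cos u * t - cos v * s) / (2 * s * t) - (t\<^sup>2 - s\<^sup>2) / (4 * s\<^sup>2 * t\<^sup>2)"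
    unfolding u_sum v_sum using s t by (simp add: field_simps power2_eq_square)
  also have "cos u * t - cos v * s = sin \<xi>"
    using sin_diff[of v u] by (simp add: uv st mult.commute)
  also have "t\<^sup>2 - s\<^sup>2 = sin \<psi> * sin \<xi>"
  proof -
    have "sin \<psi> * sin \<xi> = (sin v * cos u)\<^sup>2 - (cos v * sin u)\<^sup>2"
      unfolding uv(3,4)[symmetric] sin_add sin_diff by algebra
    also have "\<dots> = (sin v)\<^sup>2 - (sin u)\<^sup>2"
      by (simp add: power_mult_distrib cos_squared_eq algebra_simps)
    finally show ?thesis by (simp add: st)
  qed
  finally show ?thesis
    by (simp add: \<epsilon>_def algebra_simps)
qed

text \<open>
  By concavity \<open>sin ((\<psi> + \<xi>) / 2)\<close> is at least \<open>sin \<psi> / 2\<close>. The weight \<open>sin \<psi>\<close>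
  therefore compensates the denominators that contain \<open>\<psi> + \<xi>\<close>, and only those in \<open>\<psi> - \<xi>\<close>
  are left.
\<close>

lemma sine_kernel_bound:
  fixes \<psi> \<xi> :: real
  defines "s \<equiv> \<bar>sin ((\<psi> - \<xi>) / 2)\<bar>"
  assumes \<psi>: "cos (real n * \<psi>) = 0" "0 < \<psi>" "\<psi> < pi"
    and \<xi>: "sin (real n * \<xi>) = 0" "0 \<le> \<xi>" "\<xi> \<le> pi"
    and s: "s \<noteq> 0"
  shows "sin \<psi> * \<bar>sine_kernel n \<psi> \<xi>\<bar> \<le> sin \<xi> * (real n / (2 * s) + 1 / (2 * s\<^sup>2))"
proof -
  define t where "t = sin ((\<psi> + \<xi>) / 2)"
  have s0: "s > 0" using s by (simp add: s_def)
  have sin_pos: "0 < sin \<psi>" "0 \<le> sin \<xi>"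
    using \<psi> \<xi> by (auto intro: sin_gt_zero sin_ge_zero)
  have "(sin \<psi> + sin \<xi>) / 2 \<le> t"
    using concave_onD[OF concave_on_sin, of "1/2" \<psi> \<xi>] \<psi> \<xi>
    by (simp add: t_def add_divide_distrib)
  then have t_ge: "sin \<psi> \<le> 2 * t" and t0: "0 < t"
    using sin_pos by auto
  \<comment> \<open>Both terms of the closed form depend on \<open>\<psi> + \<xi>\<close> only through this bounded ratio.\<close>
  define r where "r = sin \<psi> / t"
  have r: "0 \<le> r" "r \<le> 2"
    using t_ge t0 sin_pos by (auto simp: r_def field_simps)
  define \<epsilon> where "\<epsilon> = sin (real n * \<psi>) * cos (real n * \<xi>)"
  have \<epsilon>: "\<bar>\<epsilon>\<bar> \<le> 1"
    by (simp add: \<epsilon>_def abs_mult mult_le_one)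
  define K where "K = real n * \<epsilon> / (2 * sin ((\<psi> - \<xi>) / 2) * t) - sin \<psi> / (4 * s\<^sup>2 * t\<^sup>2)"
  have kernel: "sine_kernel n \<psi> \<xi> = sin \<xi> / 2 * K"
    using sine_kernel_at_nodes[of n \<psi> \<xi>] \<psi> \<xi> s t0
    by (simp add: K_def s_def t_def \<epsilon>_def)
  have "\<bar>K\<bar> \<le> \<bar>real n * \<epsilon> / (2 * sin ((\<psi> - \<xi>) / 2) * t)\<bar> + \<bar>sin \<psi> / (4 * s\<^sup>2 * t\<^sup>2)\<bar>"
    unfolding K_def by (rule abs_triangle_ineq4)
  also have "\<dots> = real n * \<bar>\<epsilon>\<bar> / (2 * s * t) + sin \<psi> / (4 * s\<^sup>2 * t\<^sup>2)"
    using t0 sin_pos by (simp add: abs_mult s_def)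
  also have "\<dots> \<le> real n / (2 * s * t) + sin \<psi> / (4 * s\<^sup>2 * t\<^sup>2)"
    using \<epsilon> s0 t0 by (intro add_right_mono divide_right_mono) (auto intro: mult_left_le)
  finally have "sin \<psi> * \<bar>K\<bar> \<le> sin \<psi> * (real n / (2 * s * t) + sin \<psi> / (4 * s\<^sup>2 * t\<^sup>2))"
    using sin_pos by (intro mult_left_mono) auto
  also have "\<dots> = r * (real n / (2 * s)) + r\<^sup>2 * (1 / (4 * s\<^sup>2))"
    using s0 t0 by (simp add: r_def field_simps power2_eq_square)
  also have "\<dots> \<le> 2 * (real n / (2 * s)) + 2\<^sup>2 * (1 / (4 * s\<^sup>2))"
    using r s0 by (intro add_mono mult_right_mono power_mono) auto
  also have "\<dots> = 2 * (real n / (2 * s) + 1 / (2 * s\<^sup>2))"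
    by (simp add: field_simps)
  finally have "sin \<xi> / 2 * (sin \<psi> * \<bar>K\<bar>) \<le> sin \<xi> / 2 * (2 * (real n / (2 * s) + 1 / (2 * s\<^sup>2)))"
    using sin_pos by (intro mult_left_mono) auto
  then show ?thesis
    using sin_pos by (simp add: kernel abs_mult mult_ac)
qed

section \<open>Logarithmic growth\<close>

text \<open>
  To the left and to the right of the point \<open>l + 1 / 2\<close> the doubled distances of the integers are
  \<open>1, 3, 5, \<dots>\<close>; each side is dominated by a harmonic sum.
\<close>

lemma sum_inverse_odd_distance_le:
  assumes "l < n"
  shows "(\<Sum>j<n. 1 / \<bar>2 * real j - 2 * real l - 1\<bar>) \<le> 2 * harm n"
proof -
  let ?g = "\<lambda>j. 1 / \<bar>2 * real j - 2 * real l - 1\<bar>"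
  have odd_le: "(\<Sum>i<k. 1 / (2 * real i + 1)) \<le> harm n" if "k \<le> n" for k
  proof -
    have "(\<Sum>i<k. 1 / (2 * real i + 1)) \<le> harm k"
      unfolding harm_altdef by (intro sum_mono) (simp add: field_simps)
    also have "\<dots> \<le> harm n" using that by (rule harm_mono)
    finally show ?thesis .
  qed
  have "(\<Sum>j<Suc l. ?g j) = (\<Sum>i<Suc l. ?g (Suc l - Suc i))"
    by (rule sum.nat_diff_reindex[symmetric])
  also have "\<dots> = (\<Sum>i<Suc l. 1 / (2 * real i + 1))"
    by (intro sum.cong refl) (auto simp: of_nat_diff)
  finally have left: "(\<Sum>j<Suc l. ?g j) \<le> harm n"
    using odd_le[of "Suc l"] assms by simp
  have "(\<Sum>j\<in>{Suc l..<n}. ?g j) = (\<Sum>i<n - Suc l. 1 / (2 * real i + 1))"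
    by (subst sum.atLeastLessThan_shift_0) (auto simp: lessThan_atLeast0 intro!: sum.cong)
  then have right: "(\<Sum>j\<in>{Suc l..<n}. ?g j) \<le> harm n"
    using odd_le[of "n - Suc l"] by simp
  have "(\<Sum>j<n. ?g j) = (\<Sum>j<Suc l. ?g j) + (\<Sum>j\<in>{Suc l..<n}. ?g j)"
    unfolding lessThan_atLeast0 using assms by (intro sum.atLeastLessThan_concat[symmetric]) auto
  then show ?thesis using left right by linarith
qed

text \<open>
  Absorbing the additive constant of \<open>harm n \<le> 1 + ln n\<close> is where \<open>m \<ge> 1\<close> enters, through
  \<open>ln 2 \<ge> 1 / 2\<close>.
\<close>

lemma harm_le_ln:
  assumes "m \<ge> 1"
  shows "harm (2 * m + 1) \<le> 4 * ln (real m + 1)"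
proof -
  have "harm (Suc (2 * m)) - ln (Suc (2 * m)) \<le> harm (Suc 0) - ln (Suc 0)"
    using decseq_harm_diff_ln by (rule decseqD) simp
  then have "harm (2 * m + 1) - 1 \<le> ln (2 * real m + 1)"
    by (simp add: harm_expand add.commute)
  also have "ln (2 * real m + 1) \<le> ln ((real m + 1)\<^sup>2)"
  proof -
    have "2 * real m + 1 \<le> (real m + 1)\<^sup>2"
      by (simp add: power2_eq_square algebra_simps)
    moreover have "0 < (real m + 1)\<^sup>2"
      by (intro zero_less_power) simp
    ultimately show ?thesis by simp
  qed
  also have "ln ((real m + 1)\<^sup>2) = 2 * ln (real m + 1)"
    by (subst ln_realpow) auto
  finally have "harm (2 * m + 1) - 1 \<le> 2 * ln (real m + 1)" .
  moreover have "ln 2 \<le> ln (real m + 1)"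
    using assms by simp
  ultimately show ?thesis
    using ln2_ge_two_thirds by linarith
qed

section \<open>Projections of a bounded function\<close>

lemma unit_disk_eq_cball: "unit_disk = cball 0 1"
  by (auto simp: unit_disk_def norm_Pair)

lemma abs_le_unif_norm:
  assumes "continuous_on unit_disk f" "p \<in> unit_disk"
  shows "\<bar>f p\<bar> \<le> unif_norm f"
proof -
  have "compact ((\<lambda>p. \<bar>f p\<bar>) ` unit_disk)"
    using assms(1) by (intro compact_continuous_image continuous_intros) (simp_all add: unit_disk_eq_cball)
  then have "bdd_above ((\<lambda>p. \<bar>f p\<bar>) ` unit_disk)"
    by (intro bounded_imp_bdd_above compact_imp_bounded)
  then show ?thesis
    unfolding unif_norm_def using assms(2) by (intro cSUP_upper)
qed

lemma unif_norm_nonneg: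
  assumes "continuous_on unit_disk f"
  shows "0 \<le> unif_norm f"
  using abs_le_unif_norm[OF assms, of 0] by (simp add: unit_disk_eq_cball)

text \<open>The factor \<open>2 * sin \<psi>\<close> is the length of the chord at distance \<open>cos \<psi>\<close> from the centre.\<close>

lemma radon_bound:
  assumes f: "continuous_on unit_disk f" and \<psi>: "0 \<le> \<psi>" "\<psi> \<le> pi"
  shows "\<bar>radon f \<phi> (cos \<psi>)\<bar> \<le> 2 * sin \<psi> * unif_norm f"
proof -
  let ?I = "{- sin \<psi>..sin \<psi>}"
  have sin0: "0 \<le> sin \<psi>" using \<psi> by (rule sin_ge_zero)
  then have len: "sqrt (1 - (cos \<psi>)\<^sup>2) = sin \<psi>"
    by (simp add: sin_squared_eq[symmetric])
  have nrm: "(c * a - s * b)\<^sup>2 + (c * b + s * a)\<^sup>2 = (c\<^sup>2 + s\<^sup>2) * (b\<^sup>2 + a\<^sup>2)" for a b c s :: real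
    by (simp add: power2_eq_square algebra_simps)
  have disk: "line_point \<phi> (cos \<psi>) s \<in> unit_disk" if "s \<in> ?I" for s
  proof -
    have "s\<^sup>2 \<le> (sin \<psi>)\<^sup>2"
      using that sin0 by (intro abs_le_square_iff[THEN iffD1]) auto
    then have "(cos \<psi>)\<^sup>2 + s\<^sup>2 \<le> 1"
      by (simp add: sin_squared_eq)
    then show ?thesis
      by (simp add: unit_disk_def line_point_def nrm)
  qed
  have "continuous_on ?I (line_point \<phi> (cos \<psi>))"
    unfolding line_point_def by (intro continuous_intros)
  then have "continuous_on ?I (\<lambda>s. f (line_point \<phi> (cos \<psi>) s))"
    using f disk by (auto intro: continuous_on_compose2)
  then have "norm (integral ?I (\<lambda>s. f (line_point \<phi> (cos \<psi>) s)))
      \<le> unif_norm f * (sin \<psi> - - sin \<psi>)"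
    using sin0 disk abs_le_unif_norm[OF f] by (intro integral_bound) auto
  then show ?thesis
    by (simp add: radon_eq len mult_ac)
qed

section \<open>The interpolated coefficients\<close>

lemma psi_range:
  assumes "j < 2 * m + 1"
  shows "0 < psi m j" "psi m j < pi"
proof -
  have "psi m j = (2 * real j + 1) / (4 * real m + 2) * pi"
    by (simp add: psi_def)
  moreover have "0 < (2 * real j + 1) / (4 * real m + 2)" "(2 * real j + 1) / (4 * real m + 2) < 1"
    using assms by (auto simp: field_simps)
  ultimately show "0 < psi m j" "psi m j < pi"
    by (auto simp del: times_divide_eq_left)
qed

lemma xi_range:
  assumes "l < 2 * m"
  shows "0 < xi m l" "xi m l < pi"
proof -
  have "xi m l = (real l + 1) / (2 * real m + 1) * pi"
    by (simp add: xi_def)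
  moreover have "0 < (real l + 1) / (2 * real m + 1)" "(real l + 1) / (2 * real m + 1) < 1"
    using assms by (auto simp: field_simps)
  ultimately show "0 < xi m l" "xi m l < pi"
    by (auto simp del: times_divide_eq_left)
qed

lemma alpha_coeff_eq_kernel:
  "alpha_coeff m f l \<nu> = (\<Sum>j<2 * m + 1. radon f (phi m \<nu>) (cos (psi m j)) *
     sine_kernel (2 * m + 1) (psi m j) (xi m l)) / (2 * real m + 1)\<^sup>2"
proof -
  have I: "{0..2 * m} = {..<2 * m + 1}" by auto
  have "alpha_coeff m f l \<nu> = (\<Sum>k<2 * m + 1. \<Sum>j<2 * m + 1.
      radon f (phi m \<nu>) (cos (psi m j)) *
      ((real k + 1) * sin ((real k + 1) * psi m j) * sin ((real k + 1) * xi m l)) / (2 * real m + 1)\<^sup>2)"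
    unfolding alpha_coeff_def S_coeff_def I sum_distrib_left sum_distrib_right
    by (intro sum.cong refl) (simp add: mult_ac)
  also have "\<dots> = (\<Sum>j<2 * m + 1. \<Sum>k<2 * m + 1.
      radon f (phi m \<nu>) (cos (psi m j)) *
      ((real k + 1) * sin ((real k + 1) * psi m j) * sin ((real k + 1) * xi m l)) / (2 * real m + 1)\<^sup>2)"
    by (rule sum.swap)
  finally show ?thesis
    by (simp only: sine_kernel_def sum_distrib_left sum_divide_distrib)
qed

text \<open>
  With \<open>N = 2 * m + 1\<close> and \<open>d = \<bar>2 * j - 2 * l - 1\<bar>\<close>, the distance of the two nodes is
  \<open>d * pi / (2 * N)\<close>, so by Jordan's inequality the sine of half of it is at least \<open>d / (2 * N)\<close>.
  Since \<open>d\<close> is odd it is at least \<open>1\<close>, and \<open>1 / d\<^sup>2\<close> is dominated by \<open>1 / d\<close>.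
\<close>

lemma sine_kernel_grid_bound:
  assumes j: "j < 2 * m + 1" and l: "l < 2 * m"
  shows "sin (psi m j) * \<bar>sine_kernel (2 * m + 1) (psi m j) (xi m l)\<bar>
    \<le> 3 * (2 * real m + 1)\<^sup>2 * sin (xi m l) * (1 / \<bar>2 * real j - 2 * real l - 1\<bar>)"
proof -
  define N where "N = 2 * real m + 1"
  define d where "d = \<bar>2 * real j - 2 * real l - 1\<bar>"
  have N: "N \<ge> 1" "real (2 * m + 1) = N" by (simp_all add: N_def)
  have d: "1 \<le> d" "d \<le> 2 * N"
  proof -
    have "j \<le> l \<or> l + 1 \<le> j" by linarith
    then have "1 \<le> d" by (auto simp: d_def)
    moreover have "d \<le> 2 * N" using assms by (auto simp: d_def N_def)
    ultimately show "1 \<le> d" "d \<le> 2 * N" by auto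
  qed
  have \<psi>: "psi m j = (2 * real j + 1) * pi / (2 * N)" and \<xi>: "xi m l = (real l + 1) * pi / N"
    by (simp_all add: psi_def xi_def N_def)
  have N\<psi>: "N * psi m j = pi * real j + pi / 2" and N\<xi>: "N * xi m l = pi * real (Suc l)"
    using N by (simp_all add: \<psi> \<xi> field_simps)
  note \<psi>_range = psi_range[OF j] and \<xi>_range = xi_range[OF l]
  have zeros: "cos (N * psi m j) = 0" "sin (N * xi m l) = 0"
    unfolding N\<psi> N\<xi> by (simp_all add: cos_add del: of_nat_Suc)
  define s where "s = \<bar>sin ((psi m j - xi m l) / 2)\<bar>"
  have "(psi m j - xi m l) / 2 = (2 * real j - 2 * real l - 1) * pi / (4 * N)"
    using N by (simp add: \<psi> \<xi> field_simps)
  then have arg: "\<bar>(psi m j - xi m l) / 2\<bar> = d * pi / (4 * N)"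
    using N by (simp add: d_def abs_mult)
  have "\<bar>(psi m j - xi m l) / 2\<bar> \<le> pi / 2"
    unfolding arg using d N by (simp add: field_simps)
  then have "2 / pi * (d * pi / (4 * N)) \<le> s"
    unfolding s_def arg[symmetric] by (rule Jordan_sin_ineq)
  then have s_ge: "d / (2 * N) \<le> s" by simp
  then have s0: "0 < s"
    using d N by (smt (verit) divide_pos_pos)
  have "1 / s \<le> 1 / (d / (2 * N))"
    using s_ge s0 d N by (intro divide_left_mono mult_pos_pos divide_pos_pos) auto
  then have inv: "1 / s \<le> 2 * N / d" by simp
  have "N / (2 * s) + 1 / (2 * s\<^sup>2) = N / 2 * (1 / s) + (1 / s)\<^sup>2 / 2"
    by (simp add: power_divide)
  also have "\<dots> \<le> N / 2 * (2 * N / d) + (2 * N / d)\<^sup>2 / 2"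
    using inv s0 N by (intro add_mono mult_left_mono divide_right_mono power_mono) auto
  also have "\<dots> = N\<^sup>2 * (1 / d + 2 * (1 / d)\<^sup>2)"
    using d by (simp add: field_simps power2_eq_square)
  also have "\<dots> \<le> N\<^sup>2 * (1 / d + 2 * (1 / d))"
  proof -
    have "(1 / d)\<^sup>2 \<le> 1 / d"
      using d by (simp add: power2_eq_square field_simps)
    then show ?thesis by (intro mult_left_mono) auto
  qed
  finally have "N / (2 * s) + 1 / (2 * s\<^sup>2) \<le> 3 * N\<^sup>2 * (1 / d)"
    by (simp add: algebra_simps)
  then have "sin (xi m l) * (N / (2 * s) + 1 / (2 * s\<^sup>2)) \<le> sin (xi m l) * (3 * N\<^sup>2 * (1 / d))"
    using \<xi>_range by (intro mult_left_mono sin_ge_zero) auto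
  moreover have "sin (psi m j) * \<bar>sine_kernel (2 * m + 1) (psi m j) (xi m l)\<bar>
      \<le> sin (xi m l) * (N / (2 * s) + 1 / (2 * s\<^sup>2))"
    using sine_kernel_bound[of "2 * m + 1" "psi m j" "xi m l"] zeros \<psi>_range \<xi>_range s0
    unfolding N(2) s_def by simp
  ultimately show ?thesis
    by (simp add: N_def d_def mult_ac)
qed

text \<open>
  The constant is \<open>48 = 2 * 3 * 2 * 4\<close>: chord length, kernel, the two sides of the node, and
  the harmonic sum.
\<close>

lemma alpha_coeff_bound:
  assumes f: "continuous_on unit_disk f" and l: "l < 2 * m"
  shows "\<bar>alpha_coeff m f l \<nu>\<bar> \<le> 48 * unif_norm f * ln (real m + 1) * sin (xi m l)"
proof -
  define M where "M = unif_norm f"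
  define N where "N = 2 * real m + 1"
  have N: "N > 0" by (simp add: N_def)
  have M: "0 \<le> M"
    unfolding M_def using f by (rule unif_norm_nonneg)
  have \<xi>: "0 \<le> sin (xi m l)"
    using xi_range[OF l] by (intro sin_ge_zero) auto
  have term_le: "\<bar>radon f (phi m \<nu>) (cos (psi m j)) * sine_kernel (2 * m + 1) (psi m j) (xi m l)\<bar>
      \<le> 6 * M * N\<^sup>2 * sin (xi m l) * (1 / \<bar>2 * real j - 2 * real l - 1\<bar>)"
    if j: "j < 2 * m + 1" for j
  proof -
    let ?K = "\<bar>sine_kernel (2 * m + 1) (psi m j) (xi m l)\<bar>"
    have "0 \<le> psi m j" "psi m j \<le> pi"
      using psi_range[OF j] by auto
    then have "\<bar>radon f (phi m \<nu>) (cos (psi m j))\<bar> * ?K \<le> 2 * sin (psi m j) * M * ?K"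
      using radon_bound[OF f] unfolding M_def by (intro mult_right_mono) auto
    also have "\<dots> = 2 * M * (sin (psi m j) * ?K)"
      by simp
    also have "\<dots> \<le> 2 * M * (3 * N\<^sup>2 * sin (xi m l) * (1 / \<bar>2 * real j - 2 * real l - 1\<bar>))"
      using sine_kernel_grid_bound[OF j l] M unfolding N_def by (intro mult_left_mono) auto
    finally show ?thesis
      by (simp add: abs_mult mult_ac)
  qed
  have "\<bar>\<Sum>j<2 * m + 1. radon f (phi m \<nu>) (cos (psi m j)) * sine_kernel (2 * m + 1) (psi m j) (xi m l)\<bar>
      \<le> (\<Sum>j<2 * m + 1. 6 * M * N\<^sup>2 * sin (xi m l) * (1 / \<bar>2 * real j - 2 * real l - 1\<bar>))"
    using term_le by (intro order_trans[OF sum_abs] sum_mono) auto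
  also have "\<dots> = 6 * M * N\<^sup>2 * sin (xi m l) * (\<Sum>j<2 * m + 1. 1 / \<bar>2 * real j - 2 * real l - 1\<bar>)"
    by (rule sum_distrib_left[symmetric])
  also have "\<dots> \<le> 6 * M * N\<^sup>2 * sin (xi m l) * (8 * ln (real m + 1))"
    using sum_inverse_odd_distance_le[of l "2 * m + 1"] harm_le_ln[of m] l M \<xi>
    by (intro mult_left_mono) auto
  finally have "\<bar>alpha_coeff m f l \<nu>\<bar> \<le> 6 * M * N\<^sup>2 * sin (xi m l) * (8 * ln (real m + 1)) / N\<^sup>2"
    unfolding alpha_coeff_eq_kernel N_def[symmetric] abs_divide abs_of_nonneg[OF zero_le_power2]
    by (rule divide_right_mono) simp
  then show ?thesis
    using N by (simp add: M_def mult_ac)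
qed

text \<open>
  The bound by a multiple of the sine passes from the nodes to the interpolant because a concave
  function lies above its own piecewise linear interpolant.
\<close>

lemma lin_interp_bound:
  assumes f: "continuous_on unit_disk f"
    and \<theta>: "xi m 0 \<le> \<theta>" "\<theta> \<le> xi m (2 * m - 1)" and m: "m \<ge> 1"
  shows "\<bar>lin_interp m f \<nu> \<theta>\<bar> \<le> 48 * unif_norm f * ln (real m + 1) * sin \<theta>"
proof -
  define C where "C = 48 * unif_norm f * ln (real m + 1)"
  have C: "0 \<le> C"
    using unif_norm_nonneg[OF f] by (simp add: C_def)
  \<comment> \<open>The least interval whose right end is not passed also has its left end below \<open>\<theta>\<close>.\<close>
  define l where "l = (LEAST l. \<theta> \<le> xi m (l + 1))"
  have ex: "\<theta> \<le> xi m ((2 * m - 2) + 1)"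
    using \<theta>(2) m by (simp add: numeral_2_eq_2 Suc_diff_Suc)
  have l_hi: "\<theta> \<le> xi m (l + 1)"
    unfolding l_def by (rule LeastI, rule ex)
  have "l \<le> 2 * m - 2"
    unfolding l_def by (rule Least_le, rule ex)
  then have l: "l + 1 < 2 * m" using m by linarith
  have l_lo: "xi m l \<le> \<theta>"
  proof (cases l)
    case 0
    then show ?thesis using \<theta> by simp
  next
    case (Suc k)
    then have "\<not> \<theta> \<le> xi m (k + 1)"
      unfolding l_def by (metis lessI not_less_Least)
    then show ?thesis using Suc by simp
  qed
  define u where "u = interp_weight m l \<theta>"
  have gap: "xi m l < xi m (l + 1)"
    unfolding xi_def by (intro divide_strict_right_mono mult_strict_right_mono) auto
  have u: "0 \<le> u" "u \<le> 1"
    using l_lo l_hi gap by (auto simp: u_def interp_weight_def)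
  have "u * (xi m (l + 1) - xi m l) = \<theta> - xi m l"
    using gap by (simp add: u_def interp_weight_def)
  then have node: "(1 - u) * xi m l + u * xi m (l + 1) = \<theta>"
    by (simp add: algebra_simps)
  have range: "xi m k \<in> {0..pi}" if "k < 2 * m" for k
    using xi_range[OF that] by auto
  have "\<bar>lin_interp m f \<nu> \<theta>\<bar> = \<bar>u * alpha_coeff m f (l + 1) \<nu> + (1 - u) * alpha_coeff m f l \<nu>\<bar>"
    using lin_interp_eq[OF l l_lo l_hi] by (simp add: lin_piece_def u_def)
  also have "\<dots> \<le> \<bar>u * alpha_coeff m f (l + 1) \<nu>\<bar> + \<bar>(1 - u) * alpha_coeff m f l \<nu>\<bar>"
    by (rule abs_triangle_ineq)
  also have "\<dots> = u * \<bar>alpha_coeff m f (l + 1) \<nu>\<bar> + (1 - u) * \<bar>alpha_coeff m f l \<nu>\<bar>"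
    using u by (simp add: abs_mult)
  also have "\<dots> \<le> u * (C * sin (xi m (l + 1))) + (1 - u) * (C * sin (xi m l))"
    using u l alpha_coeff_bound[OF f] unfolding C_def by (intro add_mono mult_left_mono) auto
  also have "\<dots> = C * ((1 - u) * sin (xi m l) + u * sin (xi m (l + 1)))"
    by (simp add: algebra_simps)
  also have "\<dots> \<le> C * sin \<theta>"
    using concave_onD[OF concave_on_sin u range range, of l "l + 1"] l C
    by (intro mult_left_mono) (simp_all add: node[simplified])
  finally show ?thesis by (simp add: C_def)
qed

section \<open>The operator bound\<close>

text \<open>
  By the Cauchy-Schwarz inequality \<open>\<bar>x * cos \<phi> + y * sin \<phi>\<bar>\<close> is at most the norm of the point,
  hence at most \<open>cos h\<close> with \<open>h = pi / (2 * m + 1)\<close>, and the extreme nodes are \<open>h\<close> and \<open>pi - h\<close>.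
\<close>

lemma theta_in_grid:
  assumes p: "p \<in> Omega m" and m: "m \<ge> 1"
  shows "xi m 0 \<le> theta m \<nu> p" "theta m \<nu> p \<le> xi m (2 * m - 1)"
proof -
  define h where "h = pi / (2 * real m + 1)"
  have h: "0 < h" "h \<le> pi"
    by (simp_all add: h_def field_simps)
  obtain x y where p_eq: "p = (x, y)" by (cases p)
  define a where "a = x * cos (phi m \<nu>) + y * sin (phi m \<nu>)"
  have "a\<^sup>2 \<le> a\<^sup>2 + (x * sin (phi m \<nu>) - y * cos (phi m \<nu>))\<^sup>2"
    by simp
  also have "\<dots> = (x\<^sup>2 + y\<^sup>2) * ((sin (phi m \<nu>))\<^sup>2 + (cos (phi m \<nu>))\<^sup>2)"
    unfolding a_def by algebra
  finally have "\<bar>a\<bar> \<le> sqrt (x\<^sup>2 + y\<^sup>2)"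
    by (simp add: real_le_rsqrt)
  also have "\<dots> \<le> cos h"
    using p by (simp add: Omega_def p_eq h_def)
  finally have a: "\<bar>a\<bar> \<le> cos h" .
  have cos1: "cos h \<le> 1" by simp
  have "arccos (cos h) \<le> arccos a"
    using a cos1 by (intro arccos_le_arccos) linarith+
  then show "xi m 0 \<le> theta m \<nu> p"
    using h by (simp add: arccos_cos theta_def p_eq a_def xi_def h_def)
  have "arccos a \<le> arccos (- cos h)"
    using a cos1 by (intro arccos_le_arccos) linarith+
  also have "\<dots> = pi - h"
    using h cos1 a by (subst arccos_minus) (auto simp: arccos_cos)
  also have "pi - h = xi m (2 * m - 1)"
    using m by (simp add: xi_def h_def of_nat_diff field_simps)
  finally show "theta m \<nu> p \<le> xi m (2 * m - 1)"
    by (simp add: theta_def p_eq a_def)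
qed

theorem proposition3p1:
  shows "\<exists>c>0. \<forall>(m::nat) (f :: real \<times> real \<Rightarrow> real). continuous_on unit_disk f \<longrightarrow>
    (\<forall>p\<in>Omega m. \<bar>oped_lin m f p\<bar> \<le> c * unif_norm f * real m * ln (real m + 1))"
proof (intro exI[of _ 144] conjI allI impI ballI)
  fix m :: nat and f :: "real \<times> real \<Rightarrow> real" and p
  assume f: "continuous_on unit_disk f" and p: "p \<in> Omega m"
  \<comment> \<open>For \<open>m = 0\<close> the radius is \<open>cos pi = -1\<close> and there is no such point.\<close>
  have m: "m \<ge> 1"
  proof (rule ccontr)
    assume "\<not> m \<ge> 1"
    then have "m = 0" by simp
    then have "sqrt ((fst p)\<^sup>2 + (snd p)\<^sup>2) \<le> -1"
      using p by (auto simp: Omega_def)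
    moreover have "0 \<le> sqrt ((fst p)\<^sup>2 + (snd p)\<^sup>2)" by simp
    ultimately show False by linarith
  qed
  define C where "C = 48 * unif_norm f * ln (real m + 1)"
  have C: "0 \<le> C"
    using unif_norm_nonneg[OF f] by (simp add: C_def)
  have term_le: "\<bar>1 / sin (theta m \<nu> p) * lin_interp m f \<nu> (theta m \<nu> p)\<bar> \<le> C" for \<nu>
  proof -
    let ?\<theta> = "theta m \<nu> p"
    note grid = theta_in_grid[OF p m, of \<nu>]
    have "0 < xi m 0" "xi m (2 * m - 1) < pi"
      using m by (auto intro: xi_range)
    then have sin0: "0 < sin ?\<theta>"
      using grid by (intro sin_gt_zero) auto
    have "\<bar>lin_interp m f \<nu> ?\<theta>\<bar> \<le> C * sin ?\<theta>"
      unfolding C_def by (rule lin_interp_bound[OF f grid m])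
    then show ?thesis
      using sin0 by (simp add: abs_mult field_simps)
  qed
  have "\<bar>oped_lin m f p\<bar> \<le> (\<Sum>\<nu> = 0..2 * m. C)"
    unfolding oped_lin_def using term_le by (intro order_trans[OF sum_abs] sum_mono)
  also have "\<dots> = (2 * real m + 1) * C"
    by simp
  also have "\<dots> \<le> (3 * real m) * C"
    using m C by (intro mult_right_mono) auto
  finally show "\<bar>oped_lin m f p\<bar> \<le> 144 * unif_norm f * real m * ln (real m + 1)"
    by (simp add: C_def mult_ac)
qed simp

end
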